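(* Let $X_{1,1},X_{1,2},X_{2,1},X_{2,2}$ be independent random variables, each uniformly distributed on $[0,1]$. Let $\tilde X$ be the first factor of the larger of the two products $X_{1,1}X_{1,2}$ and $X_{2,1}X_{2,2}$. Then $\tilde X$ has density $$f_{\tilde X}(x)=-x\log x+\frac32x,\qquad 0< x\le 1,$$ where $\log$ is the natural logarithm.
   Context: The first factor of the larger product is $\tilde X:=X_{J,1}$, where $J\in\{1,2\}$ is the almost surely unique index maximizing $X_{j,1}X_{j,2}$. *)

theory Defs
  imports "HOL-Probability.Probability"
begin

end

theory Submission
  imports Defs "HOL-Real_Asymp.Real_Asymp"
begin

text \<open>
  Ties between the two products have probability zero, so by symmetry the density at \<open>x\<close> is twice
  the density of \<open>X_{1,1}\<close> at \<open>x\<close> restricted to the event that the first product wins. Given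
  \<open>X_{1,1} = x\<close>, this event has probability \<open>\<integral>\<^sub>0\<^sup>1 G(x v) dv\<close>, where
  \<open>G(t) = t - t ln t\<close> is the distribution function of a product of two independent uniform variables.
\<close>

section \<open>The uniform law on the unit interval and its powers\<close>

abbreviation unif :: "real measure" where
  "unif \<equiv> uniform_measure lborel {0..1}"

interpretation unif: prob_space unif
  by (rule prob_space_uniform_measure) auto

interpretation unif2: pair_prob_space unif unif ..

interpretation unif4: pair_prob_space "unif \<Otimes>\<^sub>M unif" "unif \<Otimes>\<^sub>M unif" ..

text \<open>All spaces below are \<open>UNIV\<close>, so events can be written without intersecting
  with \<open>space\<close>, and their sections simplify directly.\<close>

lemma sets_Collect_UNIV:
  assumes "Measurable.pred N P" "space N = UNIV"
  shows "{x. P x} \<in> sets N"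
  using predE[OF assms(1)] assms(2) by simp

lemma nn_integral_unif:
  assumes "f \<in> borel_measurable borel"
  shows "(\<integral>\<^sup>+x. f x \<partial>unif) = (\<integral>\<^sup>+x. f x * indicator {0..1} x \<partial>lborel)"
  using assms by (subst nn_integral_uniform_measure) (auto simp: divide_ennreal_def)

section \<open>Distribution function of a product of two uniform variables\<close>

lemma emeasure_unif_mult_le:
  fixes t y :: real
  assumes "0 < t" "0 \<le> y"
  shows "emeasure unif {w. y * w \<le> t} = ennreal (if y \<le> t then 1 else t / y)"
proof -
  have "emeasure unif {w. y * w \<le> t} = emeasure lborel ({0..1} \<inter> {w. y * w \<le> t})"
    by (subst emeasure_uniform_measure) (auto simp: divide_ennreal_def)
  \<comment> \<open>The case split, rather than \<open>min 1 (t / y)\<close>, puts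
    \<open>y = 0\<close> in the first branch: there \<open>t / y\<close> is \<open>0\<close>
    although the event is certain.\<close>
  also have "{0..1} \<inter> {w. y * w \<le> t} = {0..(if y \<le> t then 1 else t / y)}"
  proof (cases "y \<le> t")
    case True
    have "y * w \<le> t" if "0 \<le> w" "w \<le> 1" for w
      using mult_left_le[of w y] that assms True by linarith
    then show ?thesis using True by auto
  next
    case False
    then have "t / y \<le> 1" "y * w \<le> t \<longleftrightarrow> w \<le> t / y" for w
      using assms by (auto simp: field_simps)
    with False show ?thesis by fastforce
  qed
  finally show ?thesis using assms by simp
qed

text \<open>The constant part contributes \<open>t\<close>; the antiderivative
  \<open>t * ln y\<close> on \<open>{t..1}\<close> contributes \<open>- t * ln t\<close>.\<close>

lemma has_integral_min_one_divide:
  fixes t :: real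
  assumes "0 < t" "t \<le> 1"
  shows "((\<lambda>y. if y \<le> t then 1 else t / y) has_integral t - t * ln t) {0..1}"
proof -
  have "((\<lambda>y. 1) has_integral t) {0..t}"
    using has_integral_const_real[of "1::real" 0 t] assms by simp
  then have 1: "((\<lambda>y. if y \<le> t then 1 else t / y) has_integral t) {0..t}"
    by (rule has_integral_eq[rotated]) simp
  have "((\<lambda>y. t / y) has_integral t * ln 1 - t * ln t) {t..1}"
    using assms by (intro fundamental_theorem_of_calculus)
      (auto intro!: derivative_eq_intros simp: has_real_derivative_iff_has_vector_derivative[symmetric])
  then have 2: "((\<lambda>y. if y \<le> t then 1 else t / y) has_integral - t * ln t) {t..1}"
    using assms by (subst has_integral_cong[of "{t..1}" _ "\<lambda>y. t / y"]) auto
  show ?thesis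
    using has_integral_combine[OF _ _ 1 2] assms by simp
qed

text \<open>Fubini: condition on the first factor \<open>y\<close> and integrate the conditional
  probability. Positive \<open>t\<close> suffices, since later uses meet \<open>t = 0\<close> only
  on null sets.\<close>

lemma emeasure_unif_product_le:
  fixes t :: real
  assumes "0 < t" "t \<le> 1"
  shows "emeasure (unif \<Otimes>\<^sub>M unif) {p. fst p * snd p \<le> t} = ennreal (t - t * ln t)"
proof -
  have "emeasure (unif \<Otimes>\<^sub>M unif) {p. fst p * snd p \<le> t} = (\<integral>\<^sup>+y. emeasure unif {w. y * w \<le> t} \<partial>unif)"
  proof (subst unif.emeasure_pair_measure_alt)
    show "{p. fst p * snd p \<le> t} \<in> sets (unif \<Otimes>\<^sub>M unif)"
      by (rule sets_Collect_UNIV) (auto simp: space_pair_measure)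
  qed (simp add: vimage_def)
  also have "\<dots> = (\<integral>\<^sup>+y. emeasure unif {w. y * w \<le> t} * indicator {0..1} y \<partial>lborel)"
  proof (rule nn_integral_unif)
    \<comment> \<open>Section measures of a jointly measurable set are measurable. The first
      coordinate is taken over \<open>borel\<close> because \<open>nn_integral_unif\<close> asks for
      Borel measurability.\<close>
    have "{p. fst p * snd p \<le> t} \<in> sets (borel \<Otimes>\<^sub>M unif)"
      by (rule sets_Collect_UNIV) (auto simp: space_pair_measure)
    from unif.measurable_emeasure_Pair[OF this]
    show "(\<lambda>y. emeasure unif {w. y * w \<le> t}) \<in> borel_measurable borel"
      by (simp add: vimage_def)
  qed
  also have "\<dots> = (\<integral>\<^sup>+y. ennreal (if y \<le> t then 1 else t / y) * indicator {0..1} y \<partial>lborel)"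
    using assms by (intro nn_integral_cong) (simp add: emeasure_unif_mult_le del: emeasure_uniform_measure split: split_indicator)
  also have "\<dots> = ennreal (t - t * ln t)"
    using assms by (intro nn_integral_has_integral_lebesgue' has_integral_min_one_divide) auto
  finally show ?thesis .
qed

section \<open>Law of the first factor on the event that its product wins\<close>

lemma has_integral_product_cdf:
  fixes x :: real
  assumes "0 < x"
  shows "((\<lambda>v. x * v - x * v * ln (x * v)) has_integral (- x * ln x + 3 / 2 * x) / 2) {0..1}"
proof -
  \<comment> \<open>Antiderivative in \<open>v\<close>, from \<open>ln (x * v) = ln x + ln v\<close>
    and integration by parts of \<open>v * ln v\<close>.\<close>
  define F where "F = (\<lambda>v. 3 / 4 * x * v\<^sup>2 - x * ln x * v\<^sup>2 / 2 - x / 2 * (v\<^sup>2 * ln v))"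
  \<comment> \<open>The only delicate point is \<open>v = 0\<close>: the function vanishes there
    thanks to the factor \<open>v\<^sup>2\<close>, and so does its right limit.\<close>
  have cont: "continuous_on {0..1} (\<lambda>v::real. v\<^sup>2 * ln v)"
    unfolding continuous_on_def
  proof
    fix v :: real assume v: "v \<in> {0..1}"
    show "((\<lambda>v. v\<^sup>2 * ln v) \<longlongrightarrow> v\<^sup>2 * ln v) (at v within {0..1})"
    proof (cases "v = 0")
      case True
      have "((\<lambda>v::real. v\<^sup>2 * ln v) \<longlongrightarrow> 0) (at_right 0)"
        by real_asymp
      then show ?thesis
        by (simp add: True at_within_Icc_at_right)
    next
      case False
      then show ?thesis using v by (intro tendsto_intros) auto
    qed
  qed
  have "continuous_on {0..1} F"
    unfolding F_def
    by (intro continuous_on_diff[OF _ continuous_on_mult_left[OF cont]] continuous_intros) auto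
  moreover have "(F has_vector_derivative x * v - x * v * ln (x * v)) (at v)" if "v \<in> {0<..<1}" for v
    unfolding F_def has_real_derivative_iff_has_vector_derivative[symmetric]
    using that assms
    by (auto intro!: derivative_eq_intros simp: ln_mult field_simps power2_eq_square)
  \<comment> \<open>The derivative was computed for \<open>v > 0\<close> only, so the version of the
    fundamental theorem with derivatives in the interior is used.\<close>
  ultimately have "((\<lambda>v. x * v - x * v * ln (x * v)) has_integral F 1 - F 0) {0..1}"
    by (intro fundamental_theorem_of_calculus_interior) auto
  moreover have "F 1 - F 0 = (- x * ln x + 3 / 2 * x) / 2"
    by (simp add: F_def field_simps)
  ultimately show ?thesis by simp
qed

text \<open>With the winning pair fixed, the other product stays below \<open>x * v\<close> with
  probability \<open>G (x * v)\<close>; integrating over \<open>v\<close> leaves half the target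
  density.\<close>

lemma emeasure_unif4_first_factor:
  assumes [measurable]: "A \<in> sets borel"
  shows "emeasure ((unif \<Otimes>\<^sub>M unif) \<Otimes>\<^sub>M (unif \<Otimes>\<^sub>M unif)) {p. fst (fst p) \<in> A \<and> fst (snd p) * snd (snd p) \<le> fst (fst p) * snd (fst p)}
    = (\<integral>\<^sup>+x. ennreal ((if 0 < x \<and> x \<le> 1 then - x * ln x + 3 / 2 * x else 0) / 2) * indicator A x \<partial>lborel)"
    (is "emeasure ?P ?S = _")
proof -
  define G where "G = (\<lambda>t. emeasure (unif \<Otimes>\<^sub>M unif) {p. fst p * snd p \<le> t})"
  have G: "G t = ennreal (t - t * ln t)" if "0 < t" "t \<le> 1" for t
    using emeasure_unif_product_le[OF that] by (simp add: G_def)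
  have [measurable]: "G \<in> borel_measurable borel"
  proof -
    have "{p. fst (snd p) * snd (snd p) \<le> fst p} \<in> sets (borel \<Otimes>\<^sub>M (unif \<Otimes>\<^sub>M unif))"
      by (rule sets_Collect_UNIV) (auto simp: space_pair_measure)
    from unif2.measurable_emeasure_Pair[OF this] show ?thesis
      by (simp add: vimage_def G_def)
  qed
  have S: "?S \<in> sets ?P"
    by (rule sets_Collect_UNIV) (auto simp: space_pair_measure)
  have "emeasure ?P ?S = (\<integral>\<^sup>+p. G (fst p * snd p) * indicator A (fst p) \<partial>(unif \<Otimes>\<^sub>M unif))"
    unfolding unif2.emeasure_pair_measure_alt[OF S]
    by (intro nn_integral_cong)
      (auto simp: G_def vimage_def split: split_indicator)
  also have "\<dots> = (\<integral>\<^sup>+x. \<integral>\<^sup>+v. G (x * v) * indicator A x \<partial>unif \<partial>unif)"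
    by (subst unif.nn_integral_fst[symmetric]) auto
  also have "\<dots> = (\<integral>\<^sup>+x. (\<integral>\<^sup>+v. G (x * v) * indicator A x \<partial>unif) * indicator {0..1} x \<partial>lborel)"
  proof (rule nn_integral_unif)
    have "(\<lambda>x. \<integral>\<^sup>+v. G (x * v) * indicator A x \<partial>unif) \<in> borel_measurable borel"
      by (rule unif.borel_measurable_nn_integral) measurable
    then show "(\<lambda>x. \<integral>\<^sup>+v. G (x * v) * indicator A x \<partial>unif) \<in> borel_measurable borel" .
  qed
  also have "\<dots> = (\<integral>\<^sup>+x. ennreal ((if 0 < x \<and> x \<le> 1 then - x * ln x + 3 / 2 * x else 0) / 2) * indicator A x \<partial>lborel)"
  proof (rule nn_integral_cong_AE)
    have "(\<integral>\<^sup>+v. G (x * v) \<partial>unif) = ennreal ((- x * ln x + 3 / 2 * x) / 2)" if x: "0 < x" "x \<le> 1" for x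
    proof -
      have le1: "x * v \<le> 1" if "0 \<le> v" "v \<le> 1" for v
        using x that by (simp add: mult_le_one)
      have "(\<integral>\<^sup>+v. G (x * v) \<partial>unif) = (\<integral>\<^sup>+v. G (x * v) * indicator {0..1} v \<partial>lborel)"
        by (rule nn_integral_unif) measurable
      \<comment> \<open>The closed form of \<open>G\<close> needs a positive argument, so the null
        point \<open>v = 0\<close> is discarded; \<open>x = 0\<close> is treated likewise in the
        outer integral.\<close>
      also have "\<dots> = (\<integral>\<^sup>+v. ennreal (x * v - x * v * ln (x * v)) * indicator {0..1} v \<partial>lborel)"
        using AE_lborel_singleton[of "0::real"] x le1
        by (intro nn_integral_cong_AE) (auto simp: G split: split_indicator elim!: eventually_mono)
      also have "\<dots> = ennreal ((- x * ln x + 3 / 2 * x) / 2)"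
      proof (intro nn_integral_has_integral_lebesgue' has_integral_product_cdf x)
        fix v :: real assume v: "v \<in> {0..1}"
        then have "x * v * ln (x * v) \<le> 0"
          using x le1[of v] by (cases "v = 0") (auto intro!: mult_nonneg_nonpos)
        then show "0 \<le> x * v - x * v * ln (x * v)"
          using x v by (smt (verit) atLeastAtMost_iff mult_nonneg_nonneg)
      qed
      finally show ?thesis .
    qed
    then show "AE x in lborel. (\<integral>\<^sup>+v. G (x * v) * indicator A x \<partial>unif) * indicator {0..1} x
      = ennreal ((if 0 < x \<and> x \<le> 1 then - x * ln x + 3 / 2 * x else 0) / 2) * indicator A x"
      using AE_lborel_singleton[of "0::real"]
      by (auto split: split_indicator elim!: eventually_mono)
  qed
  finally show ?thesis .
qed

section \<open>Ties are null events\<close>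

lemma emeasure_unif_singleton: "emeasure unif {c} = 0"
proof -
  have "emeasure lborel ({0..1} \<inter> {c}) \<le> emeasure lborel {c}"
    by (intro emeasure_mono) auto
  then show ?thesis
    by (subst emeasure_uniform_measure) (auto simp: divide_ennreal_def)
qed

lemma AE_unif4_products_neq:
  "AE p in (unif \<Otimes>\<^sub>M unif) \<Otimes>\<^sub>M (unif \<Otimes>\<^sub>M unif). fst (fst p) * snd (fst p) \<noteq> fst (snd p) * snd (snd p)"
proof (rule unif4.AE_pair_measure)
  show "{p \<in> space ((unif \<Otimes>\<^sub>M unif) \<Otimes>\<^sub>M (unif \<Otimes>\<^sub>M unif)). fst (fst p) * snd (fst p) \<noteq> fst (snd p) * snd (snd p)}
    \<in> sets ((unif \<Otimes>\<^sub>M unif) \<Otimes>\<^sub>M (unif \<Otimes>\<^sub>M unif))"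
    by measurable
next
  have "AE q in unif \<Otimes>\<^sub>M unif. t \<noteq> fst q * snd q" for t
  proof (rule unif2.AE_pair_measure)
    show "{q \<in> space (unif \<Otimes>\<^sub>M unif). t \<noteq> fst q * snd q} \<in> sets (unif \<Otimes>\<^sub>M unif)"
      by measurable
    have ne: "AE y in unif. y \<noteq> c" for c
      using emeasure_unif_singleton[of c] by (intro AE_I[of _ _ "{c}"]) auto
    \<comment> \<open>For \<open>y\<close> nonzero, \<open>t = y * w\<close> forces \<open>w\<close>
      to be the single point \<open>t / y\<close>. The value \<open>y = 0\<close> is excluded first,
      since with \<open>t = 0\<close> every \<open>w\<close> would solve the equation.\<close>
    show "AE y in unif. AE w in unif. t \<noteq> fst (y, w) * snd (y, w)"
      using ne[of 0]
    proof eventually_elim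
      case (elim y)
      from ne[of "t / y"] show ?case
        by eventually_elim (use elim in \<open>auto simp: field_simps\<close>)
    qed
  qed
  then show "AE r in unif \<Otimes>\<^sub>M unif. AE q in unif \<Otimes>\<^sub>M unif.
      fst (fst (r, q)) * snd (fst (r, q)) \<noteq> fst (snd (r, q)) * snd (snd (r, q))"
    by simp
qed

section \<open>Transfer to the given random variables\<close>

lemma (in prob_space) distr_two_pairs:
  fixes X :: "nat \<Rightarrow> nat \<Rightarrow> 'a \<Rightarrow> real"
  assumes indep: "indep_vars (\<lambda>_. borel) (\<lambda>(j, k). X j k) ({1, 2} \<times> {1, 2})"
    and law: "\<And>j k. j \<in> {1, 2} \<Longrightarrow> k \<in> {1, 2} \<Longrightarrow> distr M borel (X j k) = N"
    and ij: "i \<in> {1, 2}" "j \<in> {1, 2}" "i \<noteq> j"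
  shows "distr M ((borel \<Otimes>\<^sub>M borel) \<Otimes>\<^sub>M (borel \<Otimes>\<^sub>M borel)) (\<lambda>\<omega>. ((X i 1 \<omega>, X i 2 \<omega>), (X j 1 \<omega>, X j 2 \<omega>)))
    = (N \<Otimes>\<^sub>M N) \<Otimes>\<^sub>M (N \<Otimes>\<^sub>M N)"
proof -
  have pair: "distr M (borel \<Otimes>\<^sub>M borel) (\<lambda>\<omega>. (X l 1 \<omega>, X l 2 \<omega>)) = N \<Otimes>\<^sub>M N" if l: "l \<in> {1, 2}" for l
  proof -
    \<comment> \<open>Disjoint blocks of indices give independent families; evaluating the families
      yields the variables themselves. Singleton blocks serve here, and the rows \<open>i\<close>
      and \<open>j\<close> below.\<close>
    have "indep_var borel ((\<lambda>f. f (l, 1)) \<circ> (\<lambda>\<omega>. restrict (\<lambda>p. (\<lambda>(j, k). X j k) p \<omega>) {(l, 1)}))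
      borel ((\<lambda>f. f (l, 2)) \<circ> (\<lambda>\<omega>. restrict (\<lambda>p. (\<lambda>(j, k). X j k) p \<omega>) {(l, 2)}))"
      using l by (intro indep_var_compose[OF indep_var_restrict[OF indep]]) auto
    then have "indep_var borel (X l 1) borel (X l 2)"
      by (simp add: comp_def)
    then show ?thesis
      using l by (simp add: indep_var_distribution_eq law)
  qed
  have "indep_var (borel \<Otimes>\<^sub>M borel)
      ((\<lambda>f. (f (i, 1), f (i, 2))) \<circ> (\<lambda>\<omega>. restrict (\<lambda>p. (\<lambda>(j, k). X j k) p \<omega>) ({i} \<times> {1, 2})))
      (borel \<Otimes>\<^sub>M borel)
      ((\<lambda>f. (f (j, 1), f (j, 2))) \<circ> (\<lambda>\<omega>. restrict (\<lambda>p. (\<lambda>(j, k). X j k) p \<omega>) ({j} \<times> {1, 2})))"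
    using ij by (intro indep_var_compose[OF indep_var_restrict[OF indep]]) auto
  then have "indep_var (borel \<Otimes>\<^sub>M borel) (\<lambda>\<omega>. (X i 1 \<omega>, X i 2 \<omega>)) (borel \<Otimes>\<^sub>M borel) (\<lambda>\<omega>. (X j 1 \<omega>, X j 2 \<omega>))"
    by (simp add: comp_def)
  then show ?thesis
    using ij by (simp add: indep_var_distribution_eq pair del: One_nat_def)
qed

theorem mainTheorem9:
  fixes M :: "'a measure"
    and X :: "nat \<Rightarrow> nat \<Rightarrow> 'a \<Rightarrow> real"
    and J :: "'a \<Rightarrow> nat"
  assumes "prob_space M"
    and "prob_space.indep_vars M (\<lambda>_. borel) (\<lambda>(j, k). X j k) ({1, 2} \<times> {1, 2})"
    and "\<And>j k. j \<in> {1, 2} \<Longrightarrow> k \<in> {1, 2} \<Longrightarrow>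
           distributed M lborel (X j k) (\<lambda>x. indicator {0..1} x / measure lborel {0..1::real})"
    and "J \<in> measurable M (count_space {1, 2})"
    and "AE \<omega> in M. is_arg_max (\<lambda>j. X j 1 \<omega> * X j 2 \<omega>) (\<lambda>j. j \<in> {1, 2}) (J \<omega>)"
  shows "distributed M lborel (\<lambda>\<omega>. X (J \<omega>) 1 \<omega>)
           (\<lambda>x. ennreal (if 0 < x \<and> x \<le> 1 then - x * ln x + 3 / 2 * x else 0))"
proof -
  interpret prob_space M by fact
  define XJ where "XJ = (\<lambda>\<omega>. X (J \<omega>) 1 \<omega>)"
  let ?f = "\<lambda>x::real. if 0 < x \<and> x \<le> 1 then - x * ln x + 3 / 2 * x else 0"
  let ?P = "(unif \<Otimes>\<^sub>M unif) \<Otimes>\<^sub>M (unif \<Otimes>\<^sub>M unif)"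
  let ?B = "(borel \<Otimes>\<^sub>M borel) \<Otimes>\<^sub>M (borel \<Otimes>\<^sub>M borel) :: ((real \<times> real) \<times> (real \<times> real)) measure"
  let ?Q = "\<lambda>i j \<omega>. ((X i 1 \<omega>, X i 2 \<omega>), (X j 1 \<omega>, X j 2 \<omega>))"
  have X: "X j k \<in> borel_measurable M" if "j \<in> {1, 2}" "k \<in> {1, 2}" for j k
    using distributed_measurable[OF assms(3)[OF that]] by simp
  then have [measurable]: "X 1 1 \<in> borel_measurable M" "X 1 2 \<in> borel_measurable M"
      "X 2 1 \<in> borel_measurable M" "X 2 2 \<in> borel_measurable M"
    by auto
  have Q: "?Q i j \<in> measurable M ?B" if "i \<in> {1, 2}" "j \<in> {1, 2}" for i j
    using that by (intro measurable_Pair X) auto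
  have law: "distr M borel (X j k) = unif" if "j \<in> {1, 2}" "k \<in> {1, 2}" for j k
  proof -
    have "distr M borel (X j k) = distr M lborel (X j k)"
      by (rule distr_cong) auto
    also have "\<dots> = unif"
      using distributed_distr_eq_density[OF assms(3)[OF that]]
      by (simp add: uniform_measure_def ennreal_indicator divide_ennreal_def)
    finally show ?thesis .
  qed
  have joint: "distr M ?B (?Q i j) = ?P" if "i \<in> {1, 2}" "j \<in> {1, 2}" "i \<noteq> j" for i j
    using distr_two_pairs[OF assms(2) law that] .
  have "AE p in distr M ?B (?Q 1 2). fst (fst p) * snd (fst p) \<noteq> fst (snd p) * snd (snd p)"
    by (subst joint) (auto intro: AE_unif4_products_neq)
  from AE_distrD[OF Q this]
  have no_tie: "AE \<omega> in M. X 1 1 \<omega> * X 1 2 \<omega> \<noteq> X 2 1 \<omega> * X 2 2 \<omega>"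
    by simp
  have J: "J \<omega> \<in> {1, 2}" if "\<omega> \<in> space M" for \<omega>
    using measurable_space[OF assms(4) that] by simp
  have J1: "Measurable.pred M (\<lambda>\<omega>. J \<omega> = 1)"
    using assms(4) by measurable
  have [measurable]: "XJ \<in> borel_measurable M"
  proof -
    \<comment> \<open>The random index is replaced by a case distinction between two measurable
      functions.\<close>
    have "(\<lambda>\<omega>. if J \<omega> = 1 then X 1 1 \<omega> else X 2 1 \<omega>) \<in> borel_measurable M"
      using J1 by measurable
    moreover have "XJ \<omega> = (if J \<omega> = 1 then X 1 1 \<omega> else X 2 1 \<omega>)" if "\<omega> \<in> space M" for \<omega>
      using J[OF that] by (auto simp: XJ_def)
    ultimately show ?thesis
      by (subst measurable_cong) assumption+
  qed
  \<comment> \<open>Needed to add the two halves of the density under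
    \<open>ennreal\<close>.\<close>
  have f_nonneg: "0 \<le> ?f x" for x
  proof (cases "0 < x \<and> x \<le> 1")
    case True
    then have "ln x \<le> 0" by simp
    then have "0 \<le> x * (3 / 2 - ln x)"
      using True by (intro mult_nonneg_nonneg) linarith+
    moreover have "?f x = x * (3 / 2 - ln x)"
      using True by (simp add: algebra_simps)
    ultimately show ?thesis by (simp only:)
  qed auto
  \<comment> \<open>This is the symmetry: \<open>joint\<close> gives the same law for both orders of
    the pairs, so one computation serves whichever product wins.\<close>
  have half: "emeasure M {\<omega> \<in> space M. X i 1 \<omega> \<in> A \<and> X j 1 \<omega> * X j 2 \<omega> \<le> X i 1 \<omega> * X i 2 \<omega>}
      = (\<integral>\<^sup>+x. ennreal (?f x / 2) * indicator A x \<partial>lborel)"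
    if [measurable]: "A \<in> sets borel" and ij: "i \<in> {1, 2}" "j \<in> {1, 2}" "i \<noteq> j" for A i j
  proof -
    let ?S = "{p. fst (fst p) \<in> A \<and> fst (snd p) * snd (snd p) \<le> fst (fst p) * snd (fst p)}"
    have S: "?S \<in> sets ?B"
      by (rule sets_Collect_UNIV) (auto simp: space_pair_measure)
    have "emeasure ?P ?S = emeasure M (?Q i j -` ?S \<inter> space M)"
      using emeasure_distr[OF Q[OF ij(1,2)] S] joint[OF ij] by simp
    also have "?Q i j -` ?S \<inter> space M
        = {\<omega> \<in> space M. X i 1 \<omega> \<in> A \<and> X j 1 \<omega> * X j 2 \<omega> \<le> X i 1 \<omega> * X i 2 \<omega>}"
      by auto
    finally show ?thesis
      using emeasure_unif4_first_factor[OF that(1)] by simp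
  qed
  have "distr M lborel XJ = density lborel (\<lambda>x. ennreal (?f x))"
  proof (rule measure_eqI)
    fix A assume "A \<in> sets (distr M lborel XJ)"
    then have A[measurable]: "A \<in> sets borel" by simp
    let ?E = "\<lambda>i j. {\<omega> \<in> space M. X i 1 \<omega> \<in> A \<and> X j 1 \<omega> * X j 2 \<omega> \<le> X i 1 \<omega> * X i 2 \<omega>}"
    have E[measurable]: "?E 1 2 \<in> sets M" "?E 2 1 \<in> sets M"
      by measurable
    have "emeasure (distr M lborel XJ) A
        = (\<integral>\<^sup>+\<omega>. indicator (XJ -` A \<inter> space M) \<omega> \<partial>M)"
      by (simp add: emeasure_distr)
    \<comment> \<open>The two events overlap only at ties, so they are disjoint just almost
      everywhere. Working with indicators allows the decomposition to hold up to a null set.\<close>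
    also have "\<dots> = (\<integral>\<^sup>+\<omega>. indicator (?E 1 2) \<omega> + indicator (?E 2 1) \<omega> \<partial>M)"
    proof (rule nn_integral_cong_AE)
      show "AE \<omega> in M. (indicator (XJ -` A \<inter> space M) \<omega> :: ennreal)
          = indicator (?E 1 2) \<omega> + indicator (?E 2 1) \<omega>"
        using assms(5) no_tie AE_space
      proof eventually_elim
        case (elim \<omega>)
        from J[OF elim(3)] consider "J \<omega> = 1" | "J \<omega> = 2" by auto
        then show ?case
          using elim by cases (auto simp: XJ_def is_arg_max_linorder indicator_def)
      qed
    qed
    also have "\<dots> = emeasure M (?E 1 2) + emeasure M (?E 2 1)"
      by (simp add: nn_integral_add E del: One_nat_def)
    also have "\<dots> = (\<integral>\<^sup>+x. ennreal (?f x / 2) * indicator A x + ennreal (?f x / 2) * indicator A x \<partial>lborel)"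
      using half[OF A, of 1 2] half[OF A, of 2 1] by (simp add: nn_integral_add del: One_nat_def)
    also have "\<dots> = (\<integral>\<^sup>+x. ennreal (?f x) * indicator A x \<partial>lborel)"
    proof (rule nn_integral_cong)
      fix x
      have "ennreal (?f x / 2) + ennreal (?f x / 2) = ennreal (?f x)"
        using f_nonneg[of x] by (subst ennreal_plus[symmetric]) (auto simp del: ennreal_plus)
      then show "ennreal (?f x / 2) * indicator A x + ennreal (?f x / 2) * indicator A x
          = ennreal (?f x) * indicator A x"
        by (metis distrib_right)
    qed
    also have "\<dots> = emeasure (density lborel (\<lambda>x. ennreal (?f x))) A"
      by (subst emeasure_density) auto
    finally show "emeasure (distr M lborel XJ) A
        = emeasure (density lborel (\<lambda>x. ennreal (?f x))) A" .
  qed simp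
  then show ?thesis
    unfolding distributed_def XJ_def[symmetric] by simp
qed

end
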